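(* Let $\mathrm{K}_V^{\mathbf t}$ be a complete $\mathbf t$-spread $d$-partite hypergraph with $V(\mathrm{K}_V^{\mathbf t})\subseteq[n]$ and $V=\{V_1,\dots,V_d\}$, where $|V_j|=n_j$ and $V_j=[i_j,i_j+n_j-1]$ for all $j=1,\dots,d$. Then $I(\mathrm{K}_V^{\mathbf t})$ is unmixed if and only if $n_1=\dots=n_d=s$ (for some $s$) and, for each $j=1,\dots,d-1$, either $i_{j+1}-(i_j+s-1)>t_j-1$ or $i_{j+1}-i_j=t_j$.
   Context: Setting. Let $n,d\ge 1$ be integers, $[n]=\{1,\dots,n\}$, $[a,b]=\{k\in\mathbb{Z}:a\le k\le b\}$, and let $\mathbf t=(t_1,\dots,t_{d-1})$ be a vector of integers with $t_i\ge 1$ for all $i$. Let $V=\{V_1,\dots,V_d\}$ be a family of nonempty, pairwise disjoint subsets of $[n]$ such that $p<q$ whenever $p\in V_i$, $q\in V_j$ and $i<j$. A $\mathbf t$-spread edge is a set $\{k_1,\dots,k_d\}$ with $k_j\in V_j$ for $j=1,\dots,d$ and $k_j-k_{j-1}\ge t_{j-1}$ for $j=2,\dots,d$. The complete $\mathbf t$-spread $d$-partite hypergraph $\mathrm{K}_V^{\mathbf t}$ is the hypergraph with vertex set $V(\mathrm{K}_V^{\mathbf t})=V_1\cup\dots\cup V_d$ whose edges are all the $\mathbf t$-spread edges. Standing assumption: $\mathrm{K}_V^{\mathbf t}$ has no isolated vertices, i.e. every vertex belongs to at least one edge. Let $\mathbb{K}$ be a field and $S=\mathbb{K}[x_1,\dots,x_n]$.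 The edge ideal $I(\mathrm{K}_V^{\mathbf t})\subset S$ is the ideal generated by the monomials $x_{k_1}\cdots x_{k_d}$, where $\{k_1,\dots,k_d\}$ runs over the edges of $\mathrm{K}_V^{\mathbf t}$. A square-free monomial ideal is unmixed if all its minimal prime ideals have the same height. *)

theory Defs
  imports "HOL-Algebra.Ideal" "HOL-Library.Poly_Mapping" "HOL-Library.Extended_Nat"
begin

section \<open>Complete spread multipartite hypergraphs\<close>

text \<open>A hypergraph is a pair of a vertex set and a set of edges.\<close>

type_synonym 'v hypergraph = "'v set \<times> 'v set set"

definition no_isolated_vertices :: "'v hypergraph \<Rightarrow> bool" where
  "no_isolated_vertices H \<longleftrightarrow> (\<forall>v\<in>fst H. \<exists>e\<in>snd H. v \<in> e)"

text \<open>The families \<open>V\<close> and \<open>t\<close> are functions of which only the values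
  \<open>V 1, \<dots>, V d\<close> and \<open>t 1, \<dots>, t (d - 1)\<close> matter.\<close>

definition spread_edges :: "nat \<Rightarrow> (nat \<Rightarrow> int) \<Rightarrow> (nat \<Rightarrow> int set) \<Rightarrow> int set set" where
  "spread_edges d t V =
     {k ` {1..d} | k. (\<forall>j\<in>{1..d}. k j \<in> V j) \<and> (\<forall>j\<in>{2..d}. k j - k (j - 1) \<ge> t (j - 1))}"

definition complete_spread_hypergraph ::
    "nat \<Rightarrow> (nat \<Rightarrow> int) \<Rightarrow> (nat \<Rightarrow> int set) \<Rightarrow> int hypergraph" where
  "complete_spread_hypergraph d t V = (\<Union>j\<in>{1..d}. V j, spread_edges d t V)"

section \<open>Polynomial rings and edge ideals\<close>

text \<open>\<open>(('v \<Rightarrow>\<^sub>0 nat) \<Rightarrow>\<^sub>0 'k)\<close> is the ring of polynomials over \<open>'k\<close> whose variables are indexed by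
  all of \<open>'v\<close>; \<open>mpoly_ring X\<close> is its subring of the polynomials in the variables indexed by \<open>X\<close>.\<close>

definition mpoly_ring :: "'v set \<Rightarrow> (('v \<Rightarrow>\<^sub>0 nat) \<Rightarrow>\<^sub>0 'k::field) ring" where
  "mpoly_ring X =
     \<lparr>carrier = {p. \<forall>m\<in>Poly_Mapping.keys p. Poly_Mapping.keys m \<subseteq> X},
      mult = (*), one = 1, zero = 0, add = (+)\<rparr>"

definition var :: "'v \<Rightarrow> (('v \<Rightarrow>\<^sub>0 nat) \<Rightarrow>\<^sub>0 'k::field)" where
  "var x = Poly_Mapping.single (Poly_Mapping.single x 1) 1"

definition edge_ideal :: "'v set \<Rightarrow> 'v hypergraph \<Rightarrow> (('v \<Rightarrow>\<^sub>0 nat) \<Rightarrow>\<^sub>0 'k::field) set" where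
  "edge_ideal X H = genideal (mpoly_ring X) {\<Prod>x\<in>e. var x | e. e \<in> snd H}"

lemma cring_mpoly_ring: "cring (mpoly_ring X :: (('v \<Rightarrow>\<^sub>0 nat) \<Rightarrow>\<^sub>0 'k::field) ring)"
proof -
  let ?C = "{p :: ('v \<Rightarrow>\<^sub>0 nat) \<Rightarrow>\<^sub>0 'k. \<forall>m\<in>Poly_Mapping.keys p. Poly_Mapping.keys m \<subseteq> X}"
  have add: "p + q \<in> ?C" if "p \<in> ?C" "q \<in> ?C" for p q
    using that Poly_Mapping.keys_add[of p q] by blast
  have mult: "p * q \<in> ?C" if "p \<in> ?C" "q \<in> ?C" for p q
  proof (intro CollectI ballI)
    fix m assume "m \<in> Poly_Mapping.keys (p * q)"
    then obtain a b where "m = a + b" "a \<in> Poly_Mapping.keys p" "b \<in> Poly_Mapping.keys q"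
      using keys_mult[of p q] by blast
    then show "Poly_Mapping.keys m \<subseteq> X"
      using that Poly_Mapping.keys_add[of a b] by blast
  qed
  have uminus: "- p \<in> ?C" if "p \<in> ?C" for p
    using that by simp
  have zero: "0 \<in> ?C" and one: "1 \<in> ?C"
    by simp_all
  show ?thesis
    unfolding mpoly_ring_def
  proof (intro cringI abelian_groupI comm_monoidI, unfold ring_record_simps)
    show "\<exists>q\<in>?C. q + p = 0" if "p \<in> ?C" for p
      using uminus[OF that] by (intro bexI[of _ "- p"]) simp_all
  qed (fact add mult zero one | rule add.assoc add.commute mult.assoc mult.commute distrib_right
        add_0 mult_1 | (rule add mult; assumption))+
qed

lemma var_in_mpoly_ring: "x \<in> X \<Longrightarrow> (var x :: ('v \<Rightarrow>\<^sub>0 nat) \<Rightarrow>\<^sub>0 'k::field) \<in> carrier (mpoly_ring X)"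
  by (simp add: mpoly_ring_def var_def)

section \<open>Minimal primes, height, unmixed ideals\<close>

definition minimal_primes :: "('a, 'm) ring_scheme \<Rightarrow> 'a set \<Rightarrow> 'a set set" where
  "minimal_primes R I =
     {P. primeideal P R \<and> I \<subseteq> P \<and> (\<forall>Q. primeideal Q R \<and> I \<subseteq> Q \<and> Q \<subseteq> P \<longrightarrow> Q = P)}"

text \<open>The supremum of the lengths \<open>l\<close> of chains \<open>Q 0 \<subset> \<dots> \<subset> Q l = P\<close> of prime ideals.\<close>

definition prime_height :: "('a, 'm) ring_scheme \<Rightarrow> 'a set \<Rightarrow> enat" where
  "prime_height R P =
     Sup {enat l | l Q. (\<forall>i\<le>l. primeideal (Q i) R) \<and> (\<forall>i<l. Q i \<subset> Q (Suc i)) \<and> Q l = P}"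

definition unmixed :: "('a, 'm) ring_scheme \<Rightarrow> 'a set \<Rightarrow> bool" where
  "unmixed R I \<longleftrightarrow> (\<forall>P\<in>minimal_primes R I. \<forall>Q\<in>minimal_primes R I. prime_height R P = prime_height R Q)"

end

theory Submission
  imports Defs
begin

text \<open>
  Unmixedness turns into a statement about the sizes of minimal vertex covers, which is then settled
  by looking at how two edges can be spliced.

  A prime ideal contains the edge ideal iff the variables in it form a vertex cover, so the minimal
  primes are the ideals \<open>(x\<^sub>v : v \<in> C)\<close> for the minimal vertex covers \<open>C\<close> (lemma
  \<open>minimal_primes_edge_ideal\<close>). Such an ideal has height \<open>|C|\<close> (lemma
  \<open>prime_height_monomial_prime\<close>). The lower bound is the chain obtained by adding the variables one
  at a time. For the upper bound, any chain of primes that ends in \<open>(x\<^sub>v : v \<in> C)\<close> extends in the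
  same way to the ideal of all \<open>n\<close> variables, so that it suffices that no chain of primes has more
  than \<open>n\<close> steps. To see this, choose
  \<open>y\<^sub>i \<in> Q\<^sub>i - Q\<^sub>i\<^sub>-\<^sub>1\<close> along a chain. More than \<open>n\<close> polynomials in \<open>n\<close> variables satisfy a nontrivial
  polynomial relation, by counting monomials, whereas the lexicographically lowest term of a
  relation keeps its value out of \<open>Q\<^sub>0\<close>.

  Hence the edge ideal is unmixed iff all minimal vertex covers have the same size. Since nothing is
  isolated, every part \<open>V\<^sub>j\<close> is a minimal cover, which forces \<open>|V\<^sub>j| = s\<close> for all \<open>j\<close>. Between two
  consecutive parts, write vertices as offsets \<open>a, b \<in> [0, s - 1]\<close> from the left ends of the
  intervals: the pair is allowed iff \<open>a \<le> b + \<delta>\<close> with \<open>\<delta> = i\<^sub>j\<^sub>+\<^sub>1 - i\<^sub>j - t\<^sub>j \<ge> 0\<close>. The condition of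
  the theorem says that \<open>\<delta> = 0\<close> or that all pairs are allowed (\<open>\<delta> \<ge> s - 1\<close>). If it fails, the
  offsets \<open>a \<le> \<delta>\<close> together with \<open>b \<ge> 1\<close> form a minimal cover of size \<open>s + \<delta>\<close>
  (lemma \<open>staircase_cover\<close>). If it holds throughout, the \<open>s\<close> diagonals, consisting of the vertices
  with a given offset, are edges that partition the vertex set, and a minimal cover \<open>C\<close> meets each
  of them exactly once: two vertices of \<open>C\<close> on one diagonal have edges meeting \<open>C\<close> only there, and
  the left half of one of these edges can be joined to the right half of the other so as to miss
  \<open>C\<close> (lemma \<open>minimal_cover_diagonal_unique\<close>).
\<close>

section \<open>Ideals of the polynomial ring in terms of the ambient ring operations\<close>

lemma mpoly_ring_simps [simp]:
  "mult (mpoly_ring X) = (*)" "one (mpoly_ring X) = 1" "zero (mpoly_ring X) = 0"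
  "add (mpoly_ring X) = (+)"
  by (simp_all add: mpoly_ring_def)

lemma carrier_mpoly_ring:
  "p \<in> carrier (mpoly_ring X) \<longleftrightarrow> (\<forall>m\<in>Poly_Mapping.keys p. Poly_Mapping.keys m \<subseteq> X)"
  by (simp add: mpoly_ring_def)

lemma mpoly_ring_add_closed:
  "p \<in> carrier (mpoly_ring X) \<Longrightarrow> q \<in> carrier (mpoly_ring X) \<Longrightarrow> p + q \<in> carrier (mpoly_ring X)"
  using cring.cring_simprules(1)[OF cring_mpoly_ring[of X]] by simp

lemma mpoly_ring_mult_closed:
  "p \<in> carrier (mpoly_ring X) \<Longrightarrow> q \<in> carrier (mpoly_ring X) \<Longrightarrow> p * q \<in> carrier (mpoly_ring X)"
  using cring.cring_simprules(5)[OF cring_mpoly_ring[of X]] by simp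

lemma mpoly_ring_one_closed: "1 \<in> carrier (mpoly_ring X)"
  by (simp add: carrier_mpoly_ring)

lemma mpoly_ring_const_closed: "Poly_Mapping.single 0 c \<in> carrier (mpoly_ring X)"
  by (simp add: carrier_mpoly_ring)

lemma mpoly_ring_uminus_closed: "p \<in> carrier (mpoly_ring X) \<Longrightarrow> - p \<in> carrier (mpoly_ring X)"
  by (simp add: carrier_mpoly_ring)

lemma mpoly_ring_power_closed:
  "p \<in> carrier (mpoly_ring X) \<Longrightarrow> p ^ k \<in> carrier (mpoly_ring X)"
  by (induction k) (auto intro: mpoly_ring_mult_closed mpoly_ring_one_closed)

lemma mpoly_ring_sum_closed:
  "(\<And>a. a \<in> A \<Longrightarrow> f a \<in> carrier (mpoly_ring X)) \<Longrightarrow> sum f A \<in> carrier (mpoly_ring X)"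
  by (induction A rule: infinite_finite_induct)
    (auto intro: mpoly_ring_add_closed simp: carrier_mpoly_ring[of 0])

lemma mpoly_ring_prod_closed:
  "(\<And>a. a \<in> A \<Longrightarrow> f a \<in> carrier (mpoly_ring X)) \<Longrightarrow> prod f A \<in> carrier (mpoly_ring X)"
  by (induction A rule: infinite_finite_induct)
    (auto intro: mpoly_ring_mult_closed mpoly_ring_one_closed)

lemmas mpoly_ring_closed =
  mpoly_ring_add_closed mpoly_ring_mult_closed mpoly_ring_one_closed mpoly_ring_const_closed
  mpoly_ring_uminus_closed mpoly_ring_power_closed mpoly_ring_sum_closed mpoly_ring_prod_closed

lemma mpoly_ideal_closed:
  assumes "ideal Q (mpoly_ring X)"
  shows mpoly_ideal_carrier: "p \<in> Q \<Longrightarrow> p \<in> carrier (mpoly_ring X)"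
    and mpoly_ideal_zero: "0 \<in> Q"
    and mpoly_ideal_add: "p \<in> Q \<Longrightarrow> q \<in> Q \<Longrightarrow> p + q \<in> Q"
    and mpoly_ideal_mult_left: "p \<in> Q \<Longrightarrow> q \<in> carrier (mpoly_ring X) \<Longrightarrow> q * p \<in> Q"
    and mpoly_ideal_mult_right: "p \<in> Q \<Longrightarrow> q \<in> carrier (mpoly_ring X) \<Longrightarrow> p * q \<in> Q"
    and mpoly_ideal_diff: "p \<in> Q \<Longrightarrow> q \<in> Q \<Longrightarrow> p - q \<in> Q"
proof -
  interpret ideal Q "mpoly_ring X" by fact
  show carr: "p \<in> Q \<Longrightarrow> p \<in> carrier (mpoly_ring X)" by (rule Icarr)
  show "0 \<in> Q" using additive_subgroup.zero_closed[OF additive_subgroup_axioms] by simp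
  show add: "p \<in> Q \<Longrightarrow> q \<in> Q \<Longrightarrow> p + q \<in> Q" for p q
    using additive_subgroup.a_closed[OF additive_subgroup_axioms] by simp
  show mult: "p \<in> Q \<Longrightarrow> q \<in> carrier (mpoly_ring X) \<Longrightarrow> q * p \<in> Q" for p q
    using I_l_closed by simp
  show "p \<in> Q \<Longrightarrow> q \<in> carrier (mpoly_ring X) \<Longrightarrow> p * q \<in> Q"
    using I_r_closed by simp
  show "p - q \<in> Q" if "p \<in> Q" "q \<in> Q"
    using add[OF that(1) mult[OF that(2) mpoly_ring_uminus_closed[OF mpoly_ring_one_closed]]]
    by simp
qed

lemma mpoly_ideal_sum:
  assumes "ideal Q (mpoly_ring X)" "\<And>a. a \<in> A \<Longrightarrow> f a \<in> Q"
  shows "sum f A \<in> Q"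
  using assms(2)
  by (induction A rule: infinite_finite_induct)
    (auto intro: mpoly_ideal_zero[OF assms(1)] mpoly_ideal_add[OF assms(1)])

lemma mpoly_primeD:
  assumes "primeideal Q (mpoly_ring X)"
  shows mpoly_prime_ideal: "ideal Q (mpoly_ring X)"
    and mpoly_prime_mult: "p \<in> carrier (mpoly_ring X) \<Longrightarrow> q \<in> carrier (mpoly_ring X) \<Longrightarrow>
      p * q \<in> Q \<Longrightarrow> p \<in> Q \<or> q \<in> Q"
    and mpoly_prime_one: "1 \<notin> Q"
proof -
  interpret primeideal Q "mpoly_ring X" by fact
  show "ideal Q (mpoly_ring X)" by (rule is_ideal)
  show "p \<in> carrier (mpoly_ring X) \<Longrightarrow> q \<in> carrier (mpoly_ring X) \<Longrightarrow>
      p * q \<in> Q \<Longrightarrow> p \<in> Q \<or> q \<in> Q" using I_prime by simp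
  show "1 \<notin> Q" using one_imp_carrier I_notcarr by auto
qed

lemma mpoly_prime_const:
  assumes "primeideal Q (mpoly_ring X)" "c \<noteq> 0"
  shows "Poly_Mapping.single 0 c \<notin> Q"
proof
  assume "Poly_Mapping.single 0 c \<in> Q"
  then have "Poly_Mapping.single 0 (inverse c) * Poly_Mapping.single 0 c \<in> Q"
    using mpoly_ideal_mult_left mpoly_prime_ideal[OF assms(1)] mpoly_ring_const_closed by blast
  moreover have "Poly_Mapping.single 0 (inverse c) * Poly_Mapping.single 0 c = 1"
    using assms(2) by (simp add: mult_single)
  ultimately show False using mpoly_prime_one[OF assms(1)] by metis
qed

lemma mpoly_prime_power:
  assumes "primeideal Q (mpoly_ring X)" "p \<in> carrier (mpoly_ring X)" "p ^ k \<in> Q"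
  shows "p \<in> Q"
  using assms(3)
proof (induction k)
  case 0 then show ?case using mpoly_prime_one[OF assms(1)] by simp
next
  case (Suc k)
  then show ?case
    using mpoly_prime_mult[OF assms(1,2) mpoly_ring_power_closed[OF assms(2)]] by auto
qed

lemma mpoly_prime_prod:
  assumes "primeideal Q (mpoly_ring X)" "finite A" "\<And>a. a \<in> A \<Longrightarrow> f a \<in> carrier (mpoly_ring X)"
    and "prod f A \<in> Q"
  shows "\<exists>a\<in>A. f a \<in> Q"
  using assms(2-)
proof (induction A rule: finite_induct)
  case empty then show ?case using mpoly_prime_one[OF assms(1)] by simp
next
  case (insert a A)
  then show ?case
    using mpoly_prime_mult[OF assms(1), of "f a" "prod f A"] mpoly_ring_prod_closed[of A f X] by auto
qed

lemma poly_mapping_eq_sum_single: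
  "p = (\<Sum>m\<in>Poly_Mapping.keys p. Poly_Mapping.single m (Poly_Mapping.lookup p m))"
  by (rule poly_mapping_eqI)
    (simp add: lookup_sum lookup_single when_def sum.delta in_keys_iff)

section \<open>Primes generated by variables\<close>

text \<open>The ideal generated by the variables in \<open>C \<inter> X\<close>. Describing it by monomials makes membership a
condition on single terms; for \<open>C = {}\<close> it is the zero ideal, from which chains of primes start.\<close>

definition monomial_prime :: "'v set \<Rightarrow> 'v set \<Rightarrow> (('v \<Rightarrow>\<^sub>0 nat) \<Rightarrow>\<^sub>0 'k::field) set" where
  "monomial_prime X C =
     {p \<in> carrier (mpoly_ring X). \<forall>m\<in>Poly_Mapping.keys p. Poly_Mapping.keys m \<inter> C \<noteq> {}}"

lemma keys_add_nat: "Poly_Mapping.keys (a + b) = Poly_Mapping.keys a \<union> Poly_Mapping.keys b"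
  for a b :: "'v \<Rightarrow>\<^sub>0 nat"
  by (auto simp: in_keys_iff lookup_add)

lemma ideal_monomial_prime:
  "ideal (monomial_prime X C :: (('v \<Rightarrow>\<^sub>0 nat) \<Rightarrow>\<^sub>0 'k::field) set) (mpoly_ring X)"
proof -
  let ?R = "mpoly_ring X :: (('v \<Rightarrow>\<^sub>0 nat) \<Rightarrow>\<^sub>0 'k::field) ring"
  let ?P = "monomial_prime X C :: (('v \<Rightarrow>\<^sub>0 nat) \<Rightarrow>\<^sub>0 'k) set"
  interpret R: cring ?R by (rule cring_mpoly_ring)
  have mult: "q * p \<in> ?P" if "p \<in> ?P" "q \<in> carrier ?R" for p q
  proof -
    have "Poly_Mapping.keys m \<inter> C \<noteq> {}" if m: "m \<in> Poly_Mapping.keys (q * p)" for m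
    proof -
      obtain a b where "m = a + b" "b \<in> Poly_Mapping.keys p"
        using m keys_mult[of q p] by blast
      then show ?thesis using \<open>p \<in> ?P\<close> by (auto simp: monomial_prime_def keys_add_nat)
    qed
    then show ?thesis using that mpoly_ring_mult_closed by (auto simp: monomial_prime_def)
  qed
  have add: "p + q \<in> ?P" if "p \<in> ?P" "q \<in> ?P" for p q
    using that mpoly_ring_add_closed keys_add[of p q] by (auto simp: monomial_prime_def)
  have inv: "\<ominus>\<^bsub>?R\<^esub> p \<in> ?P" if "p \<in> ?P" for p
  proof -
    have "- p \<in> ?P" using that by (simp add: monomial_prime_def carrier_mpoly_ring)
    moreover have "\<ominus>\<^bsub>?R\<^esub> p = - p"
      using that mpoly_ring_uminus_closed
      by (intro R.minus_equality) (auto simp: monomial_prime_def)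
    ultimately show ?thesis by simp
  qed
  show ?thesis
  proof (rule idealI)
    show "ring ?R" by (rule R.ring_axioms)
    show "subgroup ?P (add_monoid ?R)"
    proof (rule R.add.subgroupI)
      show "?P \<subseteq> carrier ?R" by (auto simp: monomial_prime_def)
      have "0 \<in> ?P" by (simp add: monomial_prime_def carrier_mpoly_ring)
      then show "?P \<noteq> {}" by blast
    qed (use inv add in simp_all)
    show "x \<otimes>\<^bsub>?R\<^esub> a \<in> ?P" "a \<otimes>\<^bsub>?R\<^esub> x \<in> ?P" if "a \<in> ?P" "x \<in> carrier ?R" for a x
      using mult[OF that] by (simp_all add: mult.commute)
  qed
qed

text \<open>Splitting off the terms that avoid \<open>C\<close> amounts to substituting zero for the variables in \<open>C\<close>.\<close>

lemma monomial_decomposition: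
  fixes p :: "('v \<Rightarrow>\<^sub>0 nat) \<Rightarrow>\<^sub>0 'k::field"
  assumes "p \<in> carrier (mpoly_ring X)"
  obtains p0 where "p0 \<in> carrier (mpoly_ring X)" "p - p0 \<in> monomial_prime X C"
    "\<forall>m\<in>Poly_Mapping.keys p0. Poly_Mapping.keys m \<inter> C = {}"
proof -
  define part where "part A = (\<Sum>m\<in>A. Poly_Mapping.single m (Poly_Mapping.lookup p m))" for A
  define K where "K = {m \<in> Poly_Mapping.keys p. Poly_Mapping.keys m \<inter> C = {}}"
  have keys: "Poly_Mapping.keys (part A) \<subseteq> A" for A
    unfolding part_def using keys_sum[of _ A] by (force split: if_splits)
  have "p = part (Poly_Mapping.keys p)"
    unfolding part_def by (rule poly_mapping_eq_sum_single)
  also have "\<dots> = part (Poly_Mapping.keys p - K) + part K"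
    unfolding part_def by (rule sum.subset_diff) (auto simp: K_def)
  finally have "p - part K = part (Poly_Mapping.keys p - K)" by (simp add: algebra_simps)
  moreover have "part (Poly_Mapping.keys p - K) \<in> monomial_prime X C"
    using keys[of "Poly_Mapping.keys p - K"] assms
    by (force simp: monomial_prime_def carrier_mpoly_ring K_def)
  moreover have "part K \<in> carrier (mpoly_ring X)"
    using keys[of K] assms by (force simp: carrier_mpoly_ring K_def)
  moreover have "\<forall>m\<in>Poly_Mapping.keys (part K). Poly_Mapping.keys m \<inter> C = {}"
    using keys[of K] by (auto simp: K_def)
  ultimately show ?thesis using that by simp
qed

text \<open>Modulo the ideal, each factor may be replaced by its part \<open>p0\<close>, \<open>q0\<close> that avoids the variables in
\<open>C\<close>. The monomials of \<open>p0 * q0\<close> avoid \<open>C\<close> as well, so that \<open>p0 * q0\<close> lies in the ideal only if it is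
zero, and polynomials have no zero divisors. The latter fact is where an order on the variables
comes in: it provides a monomial order.\<close>

lemma primeideal_monomial_prime:
  "primeideal (monomial_prime X C :: (('v::linorder \<Rightarrow>\<^sub>0 nat) \<Rightarrow>\<^sub>0 'k::field) set) (mpoly_ring X)"
proof (rule primeidealI)
  let ?R = "mpoly_ring X :: (('v \<Rightarrow>\<^sub>0 nat) \<Rightarrow>\<^sub>0 'k) ring"
  let ?P = "monomial_prime X C :: (('v \<Rightarrow>\<^sub>0 nat) \<Rightarrow>\<^sub>0 'k) set"
  show id: "ideal ?P ?R" by (rule ideal_monomial_prime)
  show "cring ?R" by (rule cring_mpoly_ring)
  have "1 \<notin> ?P" by (simp add: monomial_prime_def)
  then show "carrier ?R \<noteq> ?P" using mpoly_ring_one_closed by blast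
  fix p q assume p: "p \<in> carrier ?R" and q: "q \<in> carrier ?R" and "p \<otimes>\<^bsub>?R\<^esub> q \<in> ?P"
  then have pq: "p * q \<in> ?P" by simp
  obtain p0 where p0: "p0 \<in> carrier ?R" "p - p0 \<in> ?P"
    "\<forall>m\<in>Poly_Mapping.keys p0. Poly_Mapping.keys m \<inter> C = {}"
    using monomial_decomposition[OF p] by metis
  obtain q0 where q0: "q0 \<in> carrier ?R" "q - q0 \<in> ?P"
    "\<forall>m\<in>Poly_Mapping.keys q0. Poly_Mapping.keys m \<inter> C = {}"
    using monomial_decomposition[OF q] by metis
  have "p0 * q0 = p * q - ((p - p0) * q + p0 * (q - q0))" by (simp add: algebra_simps)
  also have "\<dots> \<in> ?P"
    by (rule mpoly_ideal_diff[OF id pq mpoly_ideal_add[OF id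
          mpoly_ideal_mult_right[OF id p0(2) q] mpoly_ideal_mult_left[OF id q0(2) p0(1)]]])
  finally have in_P: "p0 * q0 \<in> ?P" .
  have "Poly_Mapping.keys (p0 * q0) = {}"
  proof (rule ccontr)
    assume "Poly_Mapping.keys (p0 * q0) \<noteq> {}"
    then obtain m where m: "m \<in> Poly_Mapping.keys (p0 * q0)" by blast
    then obtain a b where "m = a + b" "a \<in> Poly_Mapping.keys p0" "b \<in> Poly_Mapping.keys q0"
      using keys_mult[of p0 q0] by blast
    moreover have "Poly_Mapping.keys m \<inter> C \<noteq> {}" using in_P m by (simp add: monomial_prime_def)
    ultimately show False using p0(3) q0(3) by (auto simp: keys_add_nat)
  qed
  then have "p0 = 0 \<or> q0 = 0" by simp
  then show "p \<in> ?P \<or> q \<in> ?P" using p0(2) q0(2) by auto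
qed

lemma var_in_monomial_prime_iff:
  "x \<in> X \<Longrightarrow> var x \<in> monomial_prime X C \<longleftrightarrow> x \<in> C"
  using var_in_mpoly_ring[of x X] by (auto simp: monomial_prime_def var_def)

text \<open>With \<open>var_in_monomial_prime_iff\<close>, this makes \<open>monomial_prime X C\<close> the smallest ideal that contains
the variables in \<open>C\<close>, provided that \<open>C \<subseteq> X\<close>.\<close>

lemma monomial_prime_subset:
  fixes Q :: "(('v \<Rightarrow>\<^sub>0 nat) \<Rightarrow>\<^sub>0 'k::field) set"
  assumes Q: "ideal Q (mpoly_ring X)" and "\<And>x. x \<in> C \<Longrightarrow> var x \<in> Q"
  shows "monomial_prime X C \<subseteq> Q"
proof
  fix p :: "('v \<Rightarrow>\<^sub>0 nat) \<Rightarrow>\<^sub>0 'k" assume p: "p \<in> monomial_prime X C"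
  have "Poly_Mapping.single m (Poly_Mapping.lookup p m) \<in> Q" if m: "m \<in> Poly_Mapping.keys p" for m
  proof -
    obtain x where x: "x \<in> Poly_Mapping.keys m" "x \<in> C"
      using p m by (auto simp: monomial_prime_def)
    \<comment> \<open>Truncated subtraction of exponents is exact here because \<open>x\<close> occurs in \<open>m\<close>.\<close>
    define m' where "m' = m - Poly_Mapping.single x 1"
    have m': "m = m' + Poly_Mapping.single x 1"
      unfolding m'_def using x(1)
      by (intro poly_mapping_eqI) (auto simp: lookup_add lookup_minus lookup_single when_def in_keys_iff)
    have "Poly_Mapping.keys m' \<subseteq> Poly_Mapping.keys m" by (subst m') (auto simp: keys_add_nat)
    also have "\<dots> \<subseteq> X" using p m by (simp add: monomial_prime_def carrier_mpoly_ring)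
    finally have "Poly_Mapping.keys m' \<subseteq> X" .
    then have "Poly_Mapping.single m' (Poly_Mapping.lookup p m) \<in> carrier (mpoly_ring X)"
      by (simp add: carrier_mpoly_ring)
    then have "Poly_Mapping.single m' (Poly_Mapping.lookup p m) * var x \<in> Q"
      using mpoly_ideal_mult_left[OF Q] assms(2) x(2) by blast
    also have "Poly_Mapping.single m' (Poly_Mapping.lookup p m) * var x =
        Poly_Mapping.single m (Poly_Mapping.lookup p m)"
      using m' by (simp add: var_def mult_single)
    finally show ?thesis .
  qed
  then have "(\<Sum>m\<in>Poly_Mapping.keys p. Poly_Mapping.single m (Poly_Mapping.lookup p m)) \<in> Q"
    by (intro mpoly_ideal_sum[OF Q])
  then show "p \<in> Q" by (simp flip: poly_mapping_eq_sum_single)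
qed

section \<open>Algebraic dependence by counting monomials\<close>

text \<open>Polynomials with monomials in \<open>M\<close> form a space of dimension at most \<open>|M|\<close>. The relation is between
indexed polynomials, so that a repetition in the family counts as a relation; this case is treated
apart because linear independence is a notion for sets.\<close>

lemma exists_linear_relation:
  fixes f :: "'e \<Rightarrow> ('v \<Rightarrow>\<^sub>0 nat) \<Rightarrow>\<^sub>0 'k::field"
  assumes "finite M" "finite E" "card M < card E" and keys: "\<And>e. e \<in> E \<Longrightarrow> Poly_Mapping.keys (f e) \<subseteq> M"
  shows "\<exists>c. (\<exists>e\<in>E. c e \<noteq> 0) \<and> (\<Sum>e\<in>E. Poly_Mapping.single 0 (c e) * f e) = 0"
proof (cases "inj_on f E")
  case True
  interpret vector_space "\<lambda>c p. Poly_Mapping.single 0 c * p :: ('v \<Rightarrow>\<^sub>0 nat) \<Rightarrow>\<^sub>0 'k"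
  proof unfold_locales
    show "Poly_Mapping.single 0 a * (Poly_Mapping.single 0 b * p) = Poly_Mapping.single 0 (a * b) * p"
      for a b :: 'k and p :: "('v \<Rightarrow>\<^sub>0 nat) \<Rightarrow>\<^sub>0 'k"
      by (metis mult_single add_0 mult.assoc)
  qed (simp_all add: distrib_left distrib_right single_add)
  define B :: "(('v \<Rightarrow>\<^sub>0 nat) \<Rightarrow>\<^sub>0 'k) set" where "B = (\<lambda>m. Poly_Mapping.single m 1) ` M"
  have "f ` E \<subseteq> span B"
  proof (rule image_subsetI)
    fix e assume e: "e \<in> E"
    have "Poly_Mapping.single m (Poly_Mapping.lookup (f e) m) \<in> span B"
      if "m \<in> Poly_Mapping.keys (f e)" for m
    proof -
      have "Poly_Mapping.single m (1::'k) \<in> B" using that keys[OF e] by (auto simp: B_def)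
      from span_scale[OF span_base[OF this], of "Poly_Mapping.lookup (f e) m"]
      show ?thesis by (simp add: mult_single)
    qed
    then have "(\<Sum>m\<in>Poly_Mapping.keys (f e).
        Poly_Mapping.single m (Poly_Mapping.lookup (f e) m)) \<in> span B"
      by (rule span_sum)
    then show "f e \<in> span B" by (simp flip: poly_mapping_eq_sum_single)
  qed
  moreover have "finite B" "card B < card (f ` E)"
    using assms(1,3) card_image_le[OF assms(1), of "\<lambda>m. Poly_Mapping.single m 1"] card_image[OF True]
    by (auto simp: B_def intro: le_less_trans)
  ultimately have "dependent (f ` E)"
    using independent_span_bound[of B "f ` E"] by auto
  then obtain u where "\<exists>p\<in>f ` E. u p \<noteq> 0" "(\<Sum>p\<in>f ` E. Poly_Mapping.single 0 (u p) * p) = 0"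
    using dependent_finite[of "f ` E"] assms(2) by auto
  then show ?thesis
    by (intro exI[of _ "u \<circ> f"]) (simp add: sum.reindex[OF True])
next
  case False
  then obtain a b where ab: "a \<in> E" "b \<in> E" "a \<noteq> b" "f a = f b" by (auto simp: inj_on_def)
  \<comment> \<open>For a repeated member the relation is \<open>f a - f b = 0\<close>.\<close>
  define c :: "'e \<Rightarrow> 'k" where "c e = (if e = a then 1 else if e = b then - 1 else 0)" for e
  have "(\<Sum>e\<in>E. Poly_Mapping.single 0 (c e) * f e) =
      (\<Sum>e\<in>{a, b}. Poly_Mapping.single 0 (c e) * f e)"
    using ab assms(2) by (intro sum.mono_neutral_right) (auto simp: c_def)
  also have "\<dots> = 0" using ab by (simp add: c_def single_uminus)
  finally have "(\<Sum>e\<in>E. Poly_Mapping.single 0 (c e) * f e) = 0" .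
  moreover have "\<exists>e\<in>E. c e \<noteq> 0" using ab(1) by (intro bexI[of _ a]) (simp_all add: c_def)
  ultimately show ?thesis by blast
qed

text \<open>The monomial with exponent list \<open>e\<close>, evaluated at the elements \<open>xs\<close>. Lists make the first exponent
accessible to the recursion in \<open>lowest_term_avoids_prime\<close>.\<close>

definition power_product :: "'a::comm_monoid_mult list \<Rightarrow> nat list \<Rightarrow> 'a" where
  "power_product xs e = prod_list (map2 (^) xs e)"

lemma power_product_simps [simp]:
  "power_product [] e = 1"
  "power_product (x # xs) (k # e) = x ^ k * power_product xs e"
  by (simp_all add: power_product_def)

lemma power_product_closed:
  "set xs \<subseteq> carrier (mpoly_ring X) \<Longrightarrow> power_product xs e \<in> carrier (mpoly_ring X)"
proof (induction xs arbitrary: e)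
  case Nil then show ?case by (simp add: mpoly_ring_closed)
next
  case (Cons x xs) then show ?case
    by (cases e) (simp_all add: mpoly_ring_closed power_product_def)
qed

text \<open>A bound on the exponent of each single variable, instead of on the total degree, makes the monomials
in question as easy to count as functions on the set of variables.\<close>

definition exponents_le :: "nat \<Rightarrow> (('v \<Rightarrow>\<^sub>0 nat) \<Rightarrow>\<^sub>0 'k::zero) \<Rightarrow> bool" where
  "exponents_le D p \<longleftrightarrow> (\<forall>m\<in>Poly_Mapping.keys p. \<forall>v. Poly_Mapping.lookup m v \<le> D)"

lemma exponents_le_mult:
  fixes p q :: "('v \<Rightarrow>\<^sub>0 nat) \<Rightarrow>\<^sub>0 'k::semiring_0"
  assumes "exponents_le D p" "exponents_le D' q"
  shows "exponents_le (D + D') (p * q)"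
  unfolding exponents_le_def
proof (intro ballI allI)
  fix m v assume "m \<in> Poly_Mapping.keys (p * q)"
  then obtain a b where "m = a + b" "a \<in> Poly_Mapping.keys p" "b \<in> Poly_Mapping.keys q"
    using keys_mult[of p q] by blast
  then show "Poly_Mapping.lookup m v \<le> D + D'"
    using assms by (simp add: exponents_le_def lookup_add add_mono)
qed

lemma exponents_le_power_product:
  fixes xs :: "(('v \<Rightarrow>\<^sub>0 nat) \<Rightarrow>\<^sub>0 'k::field) list"
  assumes "\<And>x. x \<in> set xs \<Longrightarrow> exponents_le D x" "set e \<subseteq> {..N}" "length e = length xs"
  shows "exponents_le (length xs * (N * D)) (power_product xs e)"
  using assms
proof (induction xs arbitrary: e)
  case Nil
  then show ?case by (simp add: exponents_le_def)
next
  case (Cons x xs)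
  then obtain k e' where e: "e = k # e'" by (cases e) auto
  have pow: "exponents_le (j * D) (x ^ j)" for j
  proof (induction j)
    case 0 then show ?case by (simp add: exponents_le_def)
  next
    case (Suc j) then show ?case
      using exponents_le_mult[of D x "j * D" "x ^ j"] Cons.prems(1) by simp
  qed
  have "k * D \<le> N * D" using Cons.prems(2) e by auto
  with pow[of k] have "exponents_le (N * D) (x ^ k)"
    unfolding exponents_le_def using le_trans by blast
  with Cons show ?case by (auto simp: e intro!: exponents_le_mult)
qed

lemma exponents_le_exists:
  fixes F :: "(('v \<Rightarrow>\<^sub>0 nat) \<Rightarrow>\<^sub>0 'k::zero) set"
  assumes "finite F"
  obtains D where "\<And>p. p \<in> F \<Longrightarrow> exponents_le D p"
proof -
  define R where "R = (\<Union>p\<in>F. \<Union>m\<in>Poly_Mapping.keys p. Poly_Mapping.range m)"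
  have "finite R" using assms by (simp add: R_def)
  then obtain D where D: "\<forall>r\<in>R. r \<le> D" by (auto simp: finite_nat_set_iff_bounded_le)
  have "exponents_le D p" if "p \<in> F" for p
    unfolding exponents_le_def
  proof (intro ballI allI)
    fix m v assume m: "m \<in> Poly_Mapping.keys p"
    have "Poly_Mapping.lookup m v \<in> R" if "v \<in> Poly_Mapping.keys m"
      using in_keys_lookup_in_range[OF that] \<open>p \<in> F\<close> m unfolding R_def by blast
    then show "Poly_Mapping.lookup m v \<le> D"
      using D by (cases "v \<in> Poly_Mapping.keys m") (auto simp: in_keys_iff)
  qed
  then show ?thesis by (rule that)
qed

lemma card_bounded_monomials:
  fixes X :: "'v set" and K :: nat
  assumes "finite X"
  defines "M \<equiv> {m :: 'v \<Rightarrow>\<^sub>0 nat. Poly_Mapping.keys m \<subseteq> X \<and> (\<forall>v. Poly_Mapping.lookup m v \<le> K)}"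
  shows "finite M" "card M \<le> (K + 1) ^ card X"
proof -
  let ?r = "\<lambda>m :: 'v \<Rightarrow>\<^sub>0 nat. restrict (Poly_Mapping.lookup m) X"
  have inj: "inj_on ?r M"
  proof (rule inj_onI, rule poly_mapping_eqI)
    fix a b v assume ab: "a \<in> M" "b \<in> M" "?r a = ?r b"
    show "Poly_Mapping.lookup a v = Poly_Mapping.lookup b v"
    proof (cases "v \<in> X")
      case True then show ?thesis using fun_cong[OF ab(3), of v] by simp
    next
      case False
      then have "v \<notin> Poly_Mapping.keys a" "v \<notin> Poly_Mapping.keys b" using ab by (auto simp: M_def)
      then show ?thesis by (simp add: in_keys_iff)
    qed
  qed
  have sub: "?r ` M \<subseteq> X \<rightarrow>\<^sub>E {..K}" by (auto simp: M_def)
  have fin: "finite (X \<rightarrow>\<^sub>E {..K})" using assms by (intro finite_PiE) auto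
  show "finite M" using inj sub fin finite_imageD finite_subset by metis
  show "card M \<le> (K + 1) ^ card X"
    using card_mono[OF fin sub] card_image[OF inj] by (simp add: card_PiE assms)
qed

text \<open>The \<open>(N + 1)\<^sup>l\<close> power products with exponents up to \<open>N\<close> have exponents up to \<open>l N D\<close> in each variable,
and there are only \<open>(l N D + 1)\<^sup>n \<le> (l D + 1)\<^sup>n (N + 1)\<^sup>n\<close> monomials of that kind. As \<open>l > n\<close>, the
former number is larger as soon as \<open>N\<close> reaches \<open>(l D + 1)\<^sup>n\<close>.\<close>

lemma algebraically_dependent:
  fixes xs :: "(('v \<Rightarrow>\<^sub>0 nat) \<Rightarrow>\<^sub>0 'k::field) list"
  assumes "finite X" "set xs \<subseteq> carrier (mpoly_ring X)" "card X < length xs"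
  shows "\<exists>E c. finite E \<and> E \<noteq> {} \<and> (\<forall>e\<in>E. length e = length xs \<and> c e \<noteq> 0) \<and>
    (\<Sum>e\<in>E. Poly_Mapping.single 0 (c e) * power_product xs e) = 0"
proof -
  let ?n = "card X" and ?l = "length xs"
  obtain D where D: "\<And>x. x \<in> set xs \<Longrightarrow> exponents_le D x"
    using exponents_le_exists[of "set xs"] by blast
  define N where "N = (?l * D + 1) ^ ?n"
  define K where "K = ?l * (N * D)"
  define M where "M = {m :: 'v \<Rightarrow>\<^sub>0 nat. Poly_Mapping.keys m \<subseteq> X \<and> (\<forall>v. Poly_Mapping.lookup m v \<le> K)}"
  define E where "E = {e :: nat list. set e \<subseteq> {..N} \<and> length e = ?l}"
  have E: "finite E" "card E = (N + 1) ^ ?l"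
    by (simp_all add: E_def finite_lists_length_eq card_lists_length_eq)
  have "card M \<le> (K + 1) ^ ?n"
    unfolding M_def by (rule card_bounded_monomials[OF assms(1)])
  also have "\<dots> \<le> ((?l * D + 1) * (N + 1)) ^ ?n"
    by (intro power_mono) (simp_all add: K_def algebra_simps)
  also have "\<dots> = N * (N + 1) ^ ?n" by (simp only: N_def power_mult_distrib)
  also have "\<dots> < (N + 1) ^ (?n + 1)" by simp
  also have "\<dots> \<le> (N + 1) ^ ?l" using assms(3) by (intro power_increasing) auto
  finally have less: "card M < card E" using E by simp
  have keys: "Poly_Mapping.keys (power_product xs e) \<subseteq> M" if "e \<in> E" for e
    using exponents_le_power_product[of xs D e N] D power_product_closed[OF assms(2), of e] that
    by (auto simp: M_def E_def K_def exponents_le_def carrier_mpoly_ring)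
  have "finite M" unfolding M_def by (rule card_bounded_monomials[OF assms(1)])
  then obtain c where c: "\<exists>e\<in>E. c e \<noteq> 0"
    "(\<Sum>e\<in>E. Poly_Mapping.single 0 (c e) * power_product xs e) = 0"
    using exists_linear_relation[of M E "power_product xs", OF _ E(1) less keys] by blast
  have "(\<Sum>e\<in>{e\<in>E. c e \<noteq> 0}. Poly_Mapping.single 0 (c e) * power_product xs e) = 0"
    using sum.mono_neutral_left[of E "{e\<in>E. c e \<noteq> 0}"
        "\<lambda>e. Poly_Mapping.single 0 (c e) * power_product xs e"] c(2) E(1) by auto
  moreover have "\<forall>e\<in>E. length e = ?l" by (simp add: E_def)
  ultimately show ?thesis
    using c(1) E(1) by (intro exI[of _ "{e\<in>E. c e \<noteq> 0}"] exI[of _ c]) auto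
qed

section \<open>Lengths of chains of primes\<close>

text \<open>Let \<open>k\<close> be the lowest exponent of the first element \<open>x\<close>. The sum is \<open>x\<^sup>k (A + x B)\<close>, where \<open>A\<close> is a
sum of the same kind in the remaining elements and hence, by induction along the rest of the chain,
not in \<open>Q 1\<close>. Since \<open>x \<in> Q 1\<close>, neither is \<open>A + x B\<close>, let alone in \<open>Q 0\<close>; and \<open>x \<notin> Q 0\<close>. At the end
of the recursion there remains a nonzero constant, which is a unit. This is the easy half of the
elementary description of Krull dimension due to Coquand and Lombardi.\<close>

lemma lowest_term_avoids_prime:
  fixes Q :: "nat \<Rightarrow> (('v \<Rightarrow>\<^sub>0 nat) \<Rightarrow>\<^sub>0 'k::field) set"
  assumes "\<And>i. i \<le> length xs \<Longrightarrow> primeideal (Q i) (mpoly_ring X)"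
    and "\<And>i. i < length xs \<Longrightarrow> Q i \<subseteq> Q (Suc i) \<and> xs ! i \<in> Q (Suc i) - Q i"
    and "finite E" "E \<noteq> {}" "\<And>e. e \<in> E \<Longrightarrow> length e = length xs" "\<And>e. e \<in> E \<Longrightarrow> c e \<noteq> 0"
  shows "(\<Sum>e\<in>E. Poly_Mapping.single 0 (c e) * power_product xs e) \<notin> Q 0"
  using assms
proof (induction xs arbitrary: Q E c)
  case Nil
  then have "E = {[]}" by auto
  then show ?case using Nil mpoly_prime_const[of "Q 0" X] by auto
next
  case (Cons x xs)
  note prime = Cons.prems(1) and step = Cons.prems(2) and len = Cons.prems(5) and c = Cons.prems(6)
  let ?term = "\<lambda>e. Poly_Mapping.single 0 (c e) * power_product (x # xs) e"
  define k where "k = Min (hd ` E)"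
  define E0 where "E0 = {e \<in> E. hd e = k}"
  define A where "A = (\<Sum>e\<in>tl ` E0. Poly_Mapping.single 0 (c (k # e)) * power_product xs e)"
  \<comment> \<open>The truncated subtraction is exact, because the first exponent exceeds \<open>k\<close> outside \<open>E0\<close>.\<close>
  define B where "B = (\<Sum>e\<in>E - E0.
    Poly_Mapping.single 0 (c e) * (x ^ (hd e - k - 1) * power_product xs (tl e)))"
  have split: "e = hd e # tl e" if "e \<in> E" for e
    using len[OF that] by (cases e) auto
  have carr: "xs ! i \<in> carrier (mpoly_ring X)" if "i < length xs" for i
    using step[of "Suc i"] mpoly_ideal_carrier[OF mpoly_prime_ideal[OF prime[of "Suc (Suc i)"]]] that
    by auto
  have x: "x \<in> Q 1" "x \<notin> Q 0" "x \<in> carrier (mpoly_ring X)"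
    using step[of 0] mpoly_ideal_carrier[OF mpoly_prime_ideal[OF prime[of 1]]] by auto
  have xs: "set xs \<subseteq> carrier (mpoly_ring X)" using carr by (auto simp: in_set_conv_nth)
  have "inj_on tl E0"
    using split by (intro inj_onI) (metis (mono_tags, lifting) E0_def mem_Collect_eq)
  then have "sum ?term E0 = x ^ k * A"
    unfolding A_def
  proof (subst sum.reindex, assumption, unfold sum_distrib_left o_def, intro sum.cong refl)
    fix e assume "e \<in> E0"
    then have "e = k # tl e" using split by (auto simp: E0_def)
    then obtain e' where "e = k # e'" by blast
    then show "?term e = x ^ k * (Poly_Mapping.single 0 (c (k # tl e)) * power_product xs (tl e))"
      by (simp add: algebra_simps)
  qed
  moreover have "sum ?term (E - E0) = x ^ k * (x * B)"
    unfolding B_def sum_distrib_left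
  proof (intro sum.cong refl)
    fix e assume e: "e \<in> E - E0"
    then obtain h e' where e': "e = h # e'" using split by blast
    have "k \<le> h" using e e' Cons.prems(3) by (auto simp: k_def intro!: Min_le image_eqI[of _ hd e])
    moreover have "h \<noteq> k" using e e' by (auto simp: E0_def)
    ultimately have "h = k + (1 + (h - k - 1))" by simp
    then have "x ^ h = x ^ k * (x * x ^ (h - k - 1))" by (metis power_add power_one_right)
    then show "?term e = x ^ k * (x *
        (Poly_Mapping.single 0 (c e) * (x ^ (hd e - k - 1) * power_product xs (tl e))))"
      by (simp add: e' algebra_simps)
  qed
  moreover have "sum ?term E = sum ?term (E - E0) + sum ?term E0"
    using Cons.prems(3) by (intro sum.subset_diff) (auto simp: E0_def)
  ultimately have eq: "sum ?term E = x ^ k * (A + x * B)" by (simp add: algebra_simps)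
  have "k \<in> hd ` E" unfolding k_def using Cons.prems(3,4) by (intro Min_in) auto
  then have "E0 \<noteq> {}" by (auto simp: E0_def)
  have "A \<notin> Q (Suc 0)"
    unfolding A_def
  proof (rule Cons.IH[of "\<lambda>i. Q (Suc i)" "tl ` E0" "\<lambda>e. c (k # e)"])
    show "primeideal (Q (Suc i)) (mpoly_ring X)" if "i \<le> length xs" for i
      using prime that by simp
    show "Q (Suc i) \<subseteq> Q (Suc (Suc i)) \<and> xs ! i \<in> Q (Suc (Suc i)) - Q (Suc i)"
      if "i < length xs" for i
      using step[of "Suc i"] that by simp
    show "finite (tl ` E0)" using Cons.prems(3) by (simp add: E0_def)
    show "tl ` E0 \<noteq> {}" using \<open>E0 \<noteq> {}\<close> by simp
    show "length e = length xs" if "e \<in> tl ` E0" for e using that len by (auto simp: E0_def)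
    show "c (k # e) \<noteq> 0" if "e \<in> tl ` E0" for e
      using that split c by (auto simp: E0_def)
  qed
  have B: "B \<in> carrier (mpoly_ring X)"
    unfolding B_def using x(3) xs by (intro mpoly_ring_closed power_product_closed)
  have A: "A \<in> carrier (mpoly_ring X)"
    unfolding A_def using xs by (intro mpoly_ring_closed power_product_closed)
  have Q1: "ideal (Q 1) (mpoly_ring X)" using mpoly_prime_ideal prime[of 1] by simp
  have "x * B \<in> Q 1" using mpoly_ideal_mult_right[OF Q1] x(1) B by blast
  then have "A + x * B \<notin> Q 1"
    using mpoly_ideal_diff[OF Q1, of "A + x * B" "x * B"] \<open>A \<notin> Q (Suc 0)\<close> by auto
  then have "A + x * B \<notin> Q 0" using step[of 0] by auto
  moreover have "x ^ k \<notin> Q 0" using mpoly_prime_power[OF prime[of 0] x(3)] x(2) by auto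
  ultimately show ?case
    unfolding eq using mpoly_prime_mult[OF prime[of 0]] A B x(3)
    by (meson le0 mpoly_ring_closed)
qed

definition prime_chain :: "('a, 'm) ring_scheme \<Rightarrow> nat \<Rightarrow> 'a set \<Rightarrow> bool" where
  "prime_chain R l P \<longleftrightarrow>
     (\<exists>Q. (\<forall>i\<le>l. primeideal (Q i) R) \<and> (\<forall>i<l. Q i \<subset> Q (Suc i)) \<and> Q l = P)"

lemma prime_height_eq_Sup: "prime_height R P = Sup {enat l | l. prime_chain R l P}"
  unfolding prime_height_def prime_chain_def by (rule arg_cong[of _ _ Sup]) blast

lemma prime_chain_0: "primeideal P R \<Longrightarrow> prime_chain R 0 P"
  by (auto simp: prime_chain_def)

lemma prime_chain_Suc:
  assumes "prime_chain R l P" "primeideal P' R" "P \<subset> P'"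
  shows "prime_chain R (Suc l) P'"
proof -
  obtain Q where "\<forall>i\<le>l. primeideal (Q i) R" "\<forall>i<l. Q i \<subset> Q (Suc i)" "Q l = P"
    using assms(1) by (auto simp: prime_chain_def)
  with assms(2,3) show ?thesis
    unfolding prime_chain_def by (intro exI[of _ "Q(Suc l := P')"]) (auto simp: le_Suc_eq less_Suc_eq)
qed

text \<open>Elements picked from the successive differences of a longer chain would be algebraically dependent,
giving an element of the kind in \<open>lowest_term_avoids_prime\<close> that is zero.\<close>

lemma prime_chain_length_le:
  fixes P :: "(('v \<Rightarrow>\<^sub>0 nat) \<Rightarrow>\<^sub>0 'k::field) set"
  assumes "finite X" "prime_chain (mpoly_ring X) l P"
  shows "l \<le> card X"
proof (rule ccontr)
  assume long: "\<not> l \<le> card X"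
  obtain Q :: "nat \<Rightarrow> (('v \<Rightarrow>\<^sub>0 nat) \<Rightarrow>\<^sub>0 'k) set"
    where Q: "\<And>i. i \<le> l \<Longrightarrow> primeideal (Q i) (mpoly_ring X)" "\<And>i. i < l \<Longrightarrow> Q i \<subset> Q (Suc i)"
    using assms(2) unfolding prime_chain_def by blast
  have "\<forall>i<l. \<exists>x. x \<in> Q (Suc i) - Q i" using Q(2) by blast
  then obtain f where f: "\<And>i. i < l \<Longrightarrow> f i \<in> Q (Suc i) - Q i" by metis
  define xs where "xs = map f [0..<l]"
  have carr: "set xs \<subseteq> carrier (mpoly_ring X)"
  proof
    fix x assume "x \<in> set xs"
    then obtain i where "i < l" "x = f i" by (auto simp: xs_def)
    then show "x \<in> carrier (mpoly_ring X)"
      using f[of i] mpoly_ideal_carrier[OF mpoly_prime_ideal[OF Q(1)[of "Suc i"]]] by auto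
  qed
  have "card X < length xs" using long by (simp add: xs_def)
  then obtain E c where E: "finite E" "E \<noteq> {}" "\<forall>e\<in>E. length e = length xs \<and> c e \<noteq> 0"
      "(\<Sum>e\<in>E. Poly_Mapping.single 0 (c e) * power_product xs e) = 0"
    using algebraically_dependent[OF assms(1) carr] by blast
  have "(\<Sum>e\<in>E. Poly_Mapping.single 0 (c e) * power_product xs e) \<notin> Q 0"
    using Q f E by (intro lowest_term_avoids_prime[where X = X]) (auto simp: xs_def)
  then show False using E(4) mpoly_ideal_zero[OF mpoly_prime_ideal[OF Q(1)[of 0]]] by simp
qed

section \<open>Heights of primes generated by variables\<close>

lemma monomial_prime_subset_iff:
  fixes C :: "'v::linorder set"
  assumes "C \<subseteq> X"
  shows "(monomial_prime X C :: (('v \<Rightarrow>\<^sub>0 nat) \<Rightarrow>\<^sub>0 'k::field) set) \<subseteq> monomial_prime X D \<longleftrightarrow> C \<subseteq> D"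
proof
  assume sub: "(monomial_prime X C :: (('v \<Rightarrow>\<^sub>0 nat) \<Rightarrow>\<^sub>0 'k) set) \<subseteq> monomial_prime X D"
  show "C \<subseteq> D"
  proof
    fix x assume "x \<in> C"
    then have "(var x :: ('v \<Rightarrow>\<^sub>0 nat) \<Rightarrow>\<^sub>0 'k) \<in> monomial_prime X C"
      using assms by (subst var_in_monomial_prime_iff) auto
    then have "(var x :: ('v \<Rightarrow>\<^sub>0 nat) \<Rightarrow>\<^sub>0 'k) \<in> monomial_prime X D" using sub by blast
    then show "x \<in> D" using assms \<open>x \<in> C\<close> by (subst (asm) var_in_monomial_prime_iff) auto
  qed
qed (auto simp: monomial_prime_def)

lemma prime_chain_monomial_prime_extend:
  fixes C :: "'v::linorder set"
  assumes "finite D" "C \<subseteq> D" "D \<subseteq> X"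
    and "prime_chain (mpoly_ring X) l (monomial_prime X C :: (('v \<Rightarrow>\<^sub>0 nat) \<Rightarrow>\<^sub>0 'k::field) set)"
  shows "prime_chain (mpoly_ring X) (l + card (D - C))
    (monomial_prime X D :: (('v \<Rightarrow>\<^sub>0 nat) \<Rightarrow>\<^sub>0 'k) set)"
proof -
  have "prime_chain (mpoly_ring X) (l + card A)
    (monomial_prime X (C \<union> A) :: (('v \<Rightarrow>\<^sub>0 nat) \<Rightarrow>\<^sub>0 'k) set)" if "finite A" "A \<subseteq> D - C" for A
    using that
  proof (induction A rule: finite_induct)
    case empty then show ?case using assms(4) by simp
  next
    case (insert x A)
    have "(monomial_prime X (C \<union> A) :: (('v \<Rightarrow>\<^sub>0 nat) \<Rightarrow>\<^sub>0 'k) set) \<subset>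
        monomial_prime X (C \<union> insert x A)"
      unfolding less_le_not_le
      using insert assms(2,3) by (subst (1 2) monomial_prime_subset_iff) auto
    from prime_chain_Suc[OF _ primeideal_monomial_prime this] insert show ?case by simp
  qed
  from this[of "D - C"] assms(1,2) show ?thesis by (simp add: Un_absorb1)
qed

text \<open>A chain of length \<open>l\<close> that ends in the ideal of \<open>C\<close> extends to one of length \<open>l + |X - C|\<close> that ends
in the ideal of all variables; the length of the latter is at most \<open>|X|\<close>.\<close>

lemma prime_height_monomial_prime:
  fixes C :: "'v::linorder set"
  assumes "finite X" "C \<subseteq> X"
  shows "prime_height (mpoly_ring X) (monomial_prime X C :: (('v \<Rightarrow>\<^sub>0 nat) \<Rightarrow>\<^sub>0 'k::field) set)
    = enat (card C)"
  unfolding prime_height_eq_Sup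
proof (rule antisym)
  let ?P = "\<lambda>C. monomial_prime X C :: (('v \<Rightarrow>\<^sub>0 nat) \<Rightarrow>\<^sub>0 'k) set"
  have fin: "finite C" using assms finite_subset by blast
  show "Sup {enat l |l. prime_chain (mpoly_ring X) l (?P C)} \<le> enat (card C)"
  proof (rule Sup_least, clarify)
    fix l assume "prime_chain (mpoly_ring X) l (?P C)"
    then have "prime_chain (mpoly_ring X) (l + card (X - C)) (?P X)"
      using assms by (intro prime_chain_monomial_prime_extend) auto
    then have "l + card (X - C) \<le> card X" by (rule prime_chain_length_le[OF assms(1)])
    moreover have "card (X - C) = card X - card C" "card C \<le> card X"
      using assms fin by (auto intro: card_Diff_subset card_mono)
    ultimately show "enat l \<le> enat (card C)" by simp
  qed
  have "prime_chain (mpoly_ring X) (0 + card (C - {})) (?P C)"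
    using fin assms(2)
    by (intro prime_chain_monomial_prime_extend prime_chain_0 primeideal_monomial_prime) auto
  then show "enat (card C) \<le> Sup {enat l |l. prime_chain (mpoly_ring X) l (?P C)}"
    by (intro Sup_upper) auto
qed

section \<open>Minimal primes of edge ideals and vertex covers\<close>

definition vertex_cover :: "'v hypergraph \<Rightarrow> 'v set \<Rightarrow> bool" where
  "vertex_cover H C \<longleftrightarrow> (\<forall>e\<in>snd H. e \<inter> C \<noteq> {})"

definition minimal_cover :: "'v hypergraph \<Rightarrow> 'v set \<Rightarrow> bool" where
  "minimal_cover H C \<longleftrightarrow> vertex_cover H C \<and> (\<forall>D\<subset>C. \<not> vertex_cover H D)"

lemma edge_ideal_subset_prime_iff:
  fixes Q :: "(('v \<Rightarrow>\<^sub>0 nat) \<Rightarrow>\<^sub>0 'k::field) set"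
  assumes "finite X" "\<Union> (snd H) \<subseteq> X" and Q: "primeideal Q (mpoly_ring X)"
  shows "edge_ideal X H \<subseteq> Q \<longleftrightarrow> vertex_cover H {x \<in> X. var x \<in> Q}"
proof -
  let ?R = "mpoly_ring X :: (('v \<Rightarrow>\<^sub>0 nat) \<Rightarrow>\<^sub>0 'k) ring"
  let ?m = "\<lambda>e. \<Prod>x\<in>e. var x :: ('v \<Rightarrow>\<^sub>0 nat) \<Rightarrow>\<^sub>0 'k"
  interpret R: cring ?R by (rule cring_mpoly_ring)
  have carr: "var x \<in> carrier ?R" if "e \<in> snd H" "x \<in> e" for e x
    using assms(2) that by (blast intro: var_in_mpoly_ring)
  have "edge_ideal X H \<subseteq> Q \<longleftrightarrow> {?m e | e. e \<in> snd H} \<subseteq> Q"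
    unfolding edge_ideal_def using carr
    by (intro R.Idl_subset_ideal mpoly_prime_ideal[OF Q]) (auto intro: mpoly_ring_prod_closed)
  also have "\<dots> \<longleftrightarrow> (\<forall>e\<in>snd H. ?m e \<in> Q)" by blast
  also have "\<dots> \<longleftrightarrow> (\<forall>e\<in>snd H. \<exists>x\<in>e. var x \<in> Q)"
  proof (intro ball_cong refl iffI)
    fix e assume e: "e \<in> snd H"
    have "e \<subseteq> X" using assms(2) e by blast
    then have fin: "finite e" using assms(1) by (rule finite_subset)
    show "\<exists>x\<in>e. var x \<in> Q" if "?m e \<in> Q"
      by (rule mpoly_prime_prod[OF Q fin _ that]) (rule carr[OF e])
    assume "\<exists>x\<in>e. var x \<in> Q"
    then obtain x where x: "x \<in> e" "var x \<in> Q" by blast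
    have "?m e = var x * ?m (e - {x})" using fin x(1) by (rule prod.remove)
    also have "\<dots> \<in> Q"
      by (rule mpoly_ideal_mult_right[OF mpoly_prime_ideal[OF Q] x(2) mpoly_ring_prod_closed])
        (use carr[OF e] in blast)
    finally show "?m e \<in> Q" .
  qed
  also have "\<dots> \<longleftrightarrow> vertex_cover H {x \<in> X. var x \<in> Q}"
    using assms(2) by (fastforce simp: vertex_cover_def)
  finally show ?thesis .
qed

text \<open>Every prime \<open>Q\<close> over the edge ideal contains the ideal generated by the variables in \<open>Q\<close>, which is
itself a prime over the edge ideal. Minimal primes are thus generated by variables, and among such
primes inclusion is inclusion of the sets of variables.\<close>

lemma minimal_primes_edge_ideal:
  fixes H :: "'v::linorder hypergraph"
  assumes "finite X" "\<Union> (snd H) \<subseteq> X"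
  shows "minimal_primes (mpoly_ring X) (edge_ideal X H :: (('v \<Rightarrow>\<^sub>0 nat) \<Rightarrow>\<^sub>0 'k::field) set)
    = monomial_prime X ` {C. C \<subseteq> X \<and> minimal_cover H C}"
proof -
  let ?R = "mpoly_ring X :: (('v \<Rightarrow>\<^sub>0 nat) \<Rightarrow>\<^sub>0 'k) ring"
  let ?I = "edge_ideal X H :: (('v \<Rightarrow>\<^sub>0 nat) \<Rightarrow>\<^sub>0 'k) set"
  let ?P = "monomial_prime X :: 'v set \<Rightarrow> (('v \<Rightarrow>\<^sub>0 nat) \<Rightarrow>\<^sub>0 'k) set"
  define vars where "vars Q = {x \<in> X. var x \<in> Q}" for Q :: "(('v \<Rightarrow>\<^sub>0 nat) \<Rightarrow>\<^sub>0 'k) set"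
  note P = primeideal_monomial_prime
  have cover_iff: "?I \<subseteq> Q \<longleftrightarrow> vertex_cover H (vars Q)" if "primeideal Q ?R" for Q
    unfolding vars_def using assms that by (rule edge_ideal_subset_prime_iff)
  have vars_P: "vars (?P C) = C" if "C \<subseteq> X" for C
    using that by (auto simp: vars_def var_in_monomial_prime_iff subset_iff)
  have P_vars: "?P (vars Q) \<subseteq> Q" if "primeideal Q ?R" for Q
    by (rule monomial_prime_subset[OF mpoly_prime_ideal[OF that]]) (simp add: vars_def)
  have vars_X: "vars Q \<subseteq> X" for Q by (auto simp: vars_def)
  show ?thesis
  proof (intro equalityI subsetI)
    fix Q assume "Q \<in> minimal_primes ?R ?I"
    then have Q: "primeideal Q ?R" "?I \<subseteq> Q" and
      min: "\<And>Q'. primeideal Q' ?R \<Longrightarrow> ?I \<subseteq> Q' \<Longrightarrow> Q' \<subseteq> Q \<Longrightarrow> Q' = Q"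
      by (auto simp: minimal_primes_def)
    have cov: "vertex_cover H (vars Q)" using Q cover_iff by blast
    have eq: "?P D = Q" if "vertex_cover H D" "D \<subseteq> vars Q" for D
    proof (rule min)
      have "D \<subseteq> X" using that(2) vars_X by blast
      then show "?I \<subseteq> ?P D" using that(1) cover_iff[OF P] vars_P by metis
      have "?P D \<subseteq> ?P (vars Q)" using that(2) by (auto simp: monomial_prime_def)
      then show "?P D \<subseteq> Q" using P_vars[OF Q(1)] by blast
    qed (rule P)
    have "minimal_cover H (vars Q)"
      unfolding minimal_cover_def
      using cov eq vars_P vars_X by (metis order_less_le order_trans)
    then show "Q \<in> ?P ` {C. C \<subseteq> X \<and> minimal_cover H C}"
      using eq[OF cov order_refl] vars_X by blast
  next
    fix Q assume "Q \<in> ?P ` {C. C \<subseteq> X \<and> minimal_cover H C}"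
    then obtain C where C: "Q = ?P C" "C \<subseteq> X" "minimal_cover H C" by blast
    have "?I \<subseteq> ?P C"
      using C cover_iff[OF P] vars_P by (metis minimal_cover_def)
    moreover have "Q' = ?P C" if Q': "primeideal Q' ?R" "?I \<subseteq> Q'" "Q' \<subseteq> ?P C" for Q'
    proof -
      have "vars Q' \<subseteq> vars (?P C)" using Q'(3) by (auto simp: vars_def)
      then have "vars Q' \<subseteq> C" using vars_P[OF C(2)] by simp
      moreover have "vertex_cover H (vars Q')" using Q'(1,2) cover_iff by blast
      ultimately have "vars Q' = C" using C(3) by (auto simp: minimal_cover_def)
      then show ?thesis using P_vars[OF Q'(1)] Q'(3) by blast
    qed
    ultimately show "Q \<in> minimal_primes ?R ?I"
      unfolding minimal_primes_def C(1) using P by blast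
  qed
qed

lemma unmixed_edge_ideal_iff:
  fixes H :: "'v::linorder hypergraph"
  assumes "finite X" "\<Union> (snd H) \<subseteq> X"
  shows "unmixed (mpoly_ring X) (edge_ideal X H :: (('v \<Rightarrow>\<^sub>0 nat) \<Rightarrow>\<^sub>0 'k::field) set) \<longleftrightarrow>
    (\<forall>C D. C \<subseteq> X \<longrightarrow> D \<subseteq> X \<longrightarrow> minimal_cover H C \<longrightarrow> minimal_cover H D \<longrightarrow> card C = card D)"
proof -
  have height: "prime_height (mpoly_ring X)
      (monomial_prime X C :: (('v \<Rightarrow>\<^sub>0 nat) \<Rightarrow>\<^sub>0 'k) set) = enat (card C)"
    if "C \<subseteq> X" for C using assms(1) that by (rule prime_height_monomial_prime)
  show ?thesis
    unfolding unmixed_def minimal_primes_edge_ideal[OF assms] by (auto simp: height)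
qed

text \<open>A vertex of a cover can be dropped unless some edge has no other vertex in the cover; these private
edges are the form in which minimality is used below.\<close>

lemma minimal_cover_iff:
  "minimal_cover H C \<longleftrightarrow> vertex_cover H C \<and> (\<forall>v\<in>C. \<exists>e\<in>snd H. e \<inter> C = {v})"
proof safe
  fix v assume min: "minimal_cover H C" and v: "v \<in> C"
  then have "C - {v} \<subset> C" by blast
  then have "\<not> vertex_cover H (C - {v})" using min by (auto simp: minimal_cover_def)
  then obtain e where "e \<in> snd H" "e \<inter> (C - {v}) = {}" by (auto simp: vertex_cover_def)
  moreover have "e \<inter> C \<noteq> {}" using min \<open>e \<in> snd H\<close> by (simp add: minimal_cover_def vertex_cover_def)
  ultimately show "\<exists>e\<in>snd H. e \<inter> C = {v}" by blast
next
  assume priv: "\<forall>v\<in>C. \<exists>e\<in>snd H. e \<inter> C = {v}" and cov: "vertex_cover H C"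
  have False if D: "D \<subset> C" "vertex_cover H D" for D
  proof -
    obtain v where v: "v \<in> C" "v \<notin> D" using D(1) by blast
    then obtain e where "e \<in> snd H" "e \<inter> C = {v}" using priv by blast
    moreover obtain x where x: "x \<in> e" "x \<in> D"
      using D(2) \<open>e \<in> snd H\<close> by (auto simp: vertex_cover_def)
    ultimately have "x \<in> {v}" using D(1) by blast
    then show False using x(2) v(2) by simp
  qed
  then show "minimal_cover H C" using cov unfolding minimal_cover_def by blast
qed (simp add: minimal_cover_def)

section \<open>Splicing edges of a spread hypergraph\<close>

text \<open>Edges with their vertices listed by part. Disjointness of the parts makes the listing unique, and
splicing two edges is a pointwise operation on listings.\<close>

definition spread_seq :: "nat \<Rightarrow> (nat \<Rightarrow> int) \<Rightarrow> (nat \<Rightarrow> int set) \<Rightarrow> (nat \<Rightarrow> int) \<Rightarrow> bool" where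
  "spread_seq d t V k \<longleftrightarrow>
     (\<forall>j\<in>{1..d}. k j \<in> V j) \<and> (\<forall>j\<in>{1..<d}. k (j + 1) - k j \<ge> t j)"

lemma spread_edges_eq: "spread_edges d t V = {k ` {1..d} | k. spread_seq d t V k}"
proof -
  have "(\<forall>j\<in>{2..d}. k j - k (j - 1) \<ge> t (j - 1)) \<longleftrightarrow> (\<forall>j\<in>{1..<d}. k (j + 1) - k j \<ge> t j)" for k
  proof -
    have "{2..d} = Suc ` {1..<d}" by (simp add: image_Suc_atLeastLessThan atLeastLessThanSuc_atLeastAtMost)
    then show ?thesis by (simp only: ball_simps) simp
  qed
  then show ?thesis unfolding spread_edges_def spread_seq_def by simp
qed

text \<open>Being spread only constrains neighbouring vertices, so only the gap at the joint needs checking.\<close>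

lemma spread_seq_splice:
  assumes "spread_seq d t V f" "spread_seq d t V g" "g (l + 1) - f l \<ge> t l"
  shows "spread_seq d t V (\<lambda>j. if j \<le> l then f j else g j)"
  using assms unfolding spread_seq_def by (auto simp: not_le dest!: le_antisym)

locale spread_hypergraph =
  fixes d :: nat and t :: "nat \<Rightarrow> int" and V :: "nat \<Rightarrow> int set"
  assumes parts_disjoint: "a \<in> {1..d} \<Longrightarrow> b \<in> {1..d} \<Longrightarrow> a \<noteq> b \<Longrightarrow> V a \<inter> V b = {}"
    and no_isolated: "no_isolated_vertices (complete_spread_hypergraph d t V)"
begin

abbreviation "H \<equiv> complete_spread_hypergraph d t V"

abbreviation "spread \<equiv> spread_seq d t V"

lemma edges_eq: "snd H = {k ` {1..d} | k. spread k}"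
  by (simp add: complete_spread_hypergraph_def spread_edges_eq)

lemma spread_mem: "spread k \<Longrightarrow> j \<in> {1..d} \<Longrightarrow> k j \<in> V j"
  by (simp add: spread_seq_def)

lemma spread_gap: "spread k \<Longrightarrow> j \<in> {1..<d} \<Longrightarrow> t j \<le> k (j + 1) - k j"
  by (simp add: spread_seq_def)

lemma spread_index_unique:
  assumes "spread k" "j \<in> {1..d}" "j' \<in> {1..d}" "k j' \<in> V j"
  shows "j' = j"
  using parts_disjoint[OF assms(2,3)] spread_mem[OF assms(1,3)] assms(4) by blast

lemma spread_through:
  assumes "j \<in> {1..d}" "v \<in> V j"
  obtains k where "spread k" "k j = v"
proof -
  have "v \<in> fst H" using assms by (auto simp: complete_spread_hypergraph_def)
  then obtain e where "e \<in> snd H" "v \<in> e"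
    using no_isolated unfolding no_isolated_vertices_def by blast
  then obtain k j' where k: "spread k" "j' \<in> {1..d}" "k j' = v" using edges_eq by auto
  then have "j' = j" using spread_index_unique[OF k(1) assms(1) k(2)] assms(2) by simp
  then show ?thesis using that k by blast
qed

lemma spread_through_pair:
  assumes "j \<in> {1..<d}" "p \<in> V j" "q \<in> V (j + 1)" "t j \<le> q - p"
  obtains k where "spread k" "k j = p" "k (j + 1) = q"
proof -
  have j: "j \<in> {1..d}" "j + 1 \<in> {1..d}" using assms(1) by auto
  obtain f where f: "spread f" "f j = p" using spread_through[OF j(1) assms(2)] .
  obtain g where g: "spread g" "g (j + 1) = q" using spread_through[OF j(2) assms(3)] .
  have "spread (\<lambda>l. if l \<le> j then f l else g l)"
    using spread_seq_splice[OF f(1) g(1)] f(2) g(2) assms(4) by simp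
  then show ?thesis by (rule that) (use f(2) g(2) in simp_all)
qed

lemma minimal_cover_subset_parts:
  assumes "minimal_cover H C"
  shows "C \<subseteq> (\<Union>j\<in>{1..d}. V j)"
proof
  fix v assume "v \<in> C"
  then obtain e where "e \<in> snd H" "e \<inter> C = {v}" using assms minimal_cover_iff by metis
  then obtain k where k: "spread k" "e = k ` {1..d}" unfolding edges_eq by auto
  have "v \<in> k ` {1..d}" using \<open>e \<inter> C = {v}\<close> k(2) by blast
  then obtain j where "j \<in> {1..d}" "v = k j" by (rule imageE)
  then show "v \<in> (\<Union>j\<in>{1..d}. V j)" using spread_mem[OF k(1)] by blast
qed

text \<open>Each edge meets \<open>V\<^sub>j\<close> in a single vertex, and each vertex of \<open>V\<^sub>j\<close> lies on an edge.\<close>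

lemma minimal_cover_part:
  assumes "j \<in> {1..d}"
  shows "minimal_cover H (V j)"
  unfolding minimal_cover_iff
proof
  show "vertex_cover H (V j)"
    unfolding vertex_cover_def edges_eq using assms spread_mem by blast
  show "\<forall>v\<in>V j. \<exists>e\<in>snd H. e \<inter> V j = {v}"
  proof
    fix v assume v: "v \<in> V j"
    obtain k where k: "spread k" "k j = v" using spread_through[OF assms v] .
    have "k ` {1..d} \<inter> V j \<subseteq> {k j}" using spread_index_unique[OF k(1) assms] by blast
    then have "k ` {1..d} \<inter> V j = {v}" using assms v k(2) by blast
    then show "\<exists>e\<in>snd H. e \<inter> V j = {v}" using k(1) edges_eq by blast
  qed
qed

lemma minimal_cover_private_spread:
  assumes "minimal_cover H C" "j \<in> {1..d}" "v \<in> V j" "v \<in> C"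
  shows "\<exists>k. spread k \<and> k j = v \<and> (\<forall>l\<in>{1..d}. k l \<in> C \<longrightarrow> l = j)"
proof -
  obtain k where k: "spread k" "k ` {1..d} \<inter> C = {v}"
    using assms(1,4) unfolding minimal_cover_iff edges_eq by blast
  have only: "l = j" if "l \<in> {1..d}" "k l \<in> C" for l
  proof -
    have "k l = v" using k(2) that by blast
    then show ?thesis using spread_index_unique[OF k(1) assms(2) that(1)] assms(3) by simp
  qed
  have "v \<in> k ` {1..d}" using k(2) by blast
  then obtain l where l: "l \<in> {1..d}" "v = k l" by (rule imageE)
  then have "l = j" using only assms(4) by simp
  then have "k j = v" using l(2) by simp
  then show ?thesis using k(1) only by blast
qed

text \<open>If the gap were large enough, the first \<open>l\<close> vertices of \<open>f\<close> followed by the later vertices of \<open>g\<close>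
would form an edge. As \<open>f\<close> meets \<open>C\<close> only in part \<open>b > l\<close> and \<open>g\<close> only in part \<open>a \<le> l\<close>, this edge
would miss \<open>C\<close>.\<close>

lemma minimal_cover_no_crossing:
  assumes C: "minimal_cover H C"
    and f: "spread f" "\<forall>l\<in>{1..d}. f l \<in> C \<longrightarrow> l = b"
    and g: "spread g" "\<forall>l\<in>{1..d}. g l \<in> C \<longrightarrow> l = a"
    and l: "a \<le> l" "l < b"
  shows "g (l + 1) - f l < t l"
proof (rule ccontr)
  let ?h = "\<lambda>j. if j \<le> l then f j else g j"
  assume "\<not> g (l + 1) - f l < t l"
  then have "spread ?h" using spread_seq_splice[OF f(1) g(1)] by simp
  then have "?h ` {1..d} \<in> snd H" unfolding edges_eq by blast
  then have "?h ` {1..d} \<inter> C \<noteq> {}" using C by (simp add: minimal_cover_def vertex_cover_def)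
  then have "\<exists>j\<in>{1..d}. ?h j \<in> C" by (simp only: disjoint_iff image_iff) blast
  then obtain j where j: "j \<in> {1..d}" "?h j \<in> C" by (rule bexE)
  show False
  proof (cases "j \<le> l")
    case True then show ?thesis using bspec[OF f(2) j(1)] j(2) l by simp
  next
    case False then show ?thesis using bspec[OF g(2) j(1)] j(2) l by simp
  qed
qed

end

section \<open>Parts that are intervals of equal length\<close>

locale spread_interval_hypergraph = spread_hypergraph +
  fixes i :: "nat \<Rightarrow> int" and s :: nat
  assumes parts_eq: "j \<in> {1..d} \<Longrightarrow> V j = {i j..i j + int s - 1}"
    and parts_nonempty: "j \<in> {1..d} \<Longrightarrow> V j \<noteq> {}"
begin

text \<open>An edge through the left end of \<open>V\<^sub>j\<^sub>+\<^sub>1\<close> has its preceding vertex at or after the left end of \<open>V\<^sub>j\<close>.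
This is how the absence of isolated vertices makes \<open>\<delta>\<close> nonnegative.\<close>

lemma left_ends_gap:
  assumes "j \<in> {1..<d}"
  shows "t j \<le> i (j + 1) - i j"
proof -
  have j: "j \<in> {1..d}" "j + 1 \<in> {1..d}" using assms by auto
  have "i (j + 1) \<in> V (j + 1)" using parts_eq[OF j(2)] parts_nonempty[OF j(2)] by auto
  from spread_through[OF j(2) this] obtain k where k: "spread k" "k (j + 1) = i (j + 1)" .
  then show ?thesis
    using spread_gap[OF k(1) assms] spread_mem[OF k(1) j(1)] parts_eq[OF j(1)] by auto
qed

text \<open>In terms of offsets \<open>a\<close>, \<open>b\<close> the cover consists of \<open>a \<le> \<delta>\<close> and \<open>b \<ge> 1\<close>, and meets every pair with
\<open>a \<le> b + \<delta>\<close>. The left end \<open>b = 0\<close> is compatible with each \<open>a \<le> \<delta>\<close>, and the offset \<open>a = \<delta> + 1\<close> with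
each \<open>b \<ge> 1\<close>, which gives the private edges. The bound \<open>\<delta> \<le> s - 2\<close> is what places \<open>\<delta> + 1\<close> inside
\<open>V\<^sub>j\<close>.\<close>

lemma staircase_cover:
  assumes j: "j \<in> {1..<d}" and \<delta>: "\<delta> = i (j + 1) - i j - t j" "1 \<le> \<delta>" "\<delta> \<le> int s - 2"
  defines "C \<equiv> {i j..i j + \<delta>} \<union> {i (j + 1) + 1..i (j + 1) + int s - 1}"
  shows "minimal_cover H C" "C \<subseteq> V j \<union> V (j + 1)" "int (card C) = int s + \<delta>"
proof -
  have j': "j \<in> {1..d}" "j + 1 \<in> {1..d}" using j by auto
  note V = parts_eq[OF j'(1)] parts_eq[OF j'(2), simplified]
  have parts: "{i j..i j + \<delta>} \<subseteq> V j" "{i (j + 1) + 1..i (j + 1) + int s - 1} \<subseteq> V (j + 1)"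
    using \<delta> by (auto simp: V)
  have sub: "C \<subseteq> V j \<union> V (j + 1)" unfolding C_def by (intro Un_mono parts)
  have V_disj: "V j \<inter> V (j + 1) = {}" using parts_disjoint[OF j'] by simp
  have disj: "{i j..i j + \<delta>} \<inter> {i (j + 1) + 1..i (j + 1) + int s - 1} = {}"
    using Int_mono[OF parts] unfolding V_disj subset_empty .
  show "C \<subseteq> V j \<union> V (j + 1)" by (rule sub)
  from disj show "int (card C) = int s + \<delta>" unfolding C_def using \<delta> by (simp add: card_Un_disjoint)
  have edge_Int: "k ` {1..d} \<inter> C = {k j, k (j + 1)} \<inter> C" if "spread k" for k
  proof -
    have "k l \<in> {k j, k (j + 1)}" if l: "l \<in> {1..d}" "k l \<in> C" for l
    proof -
      have "k l \<in> V j \<or> k l \<in> V (j + 1)" using l(2) sub by blast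
      then show ?thesis
        using spread_index_unique[OF \<open>spread k\<close> j'(1) l(1)]
          spread_index_unique[OF \<open>spread k\<close> j'(2) l(1)] by auto
    qed
    then have "k ` {1..d} \<inter> C \<subseteq> {k j, k (j + 1)}" by blast
    moreover have "{k j, k (j + 1)} \<subseteq> k ` {1..d}" using j' by simp
    ultimately show ?thesis by blast
  qed
  show "minimal_cover H C"
    unfolding minimal_cover_iff
  proof
    have "k ` {1..d} \<inter> C \<noteq> {}" if k: "spread k" for k
      using spread_mem[OF k j'(1)] spread_mem[OF k j'(2)] spread_gap[OF k j] \<delta>
      unfolding edge_Int[OF k] by (auto simp: C_def V)
    then show "vertex_cover H C" unfolding vertex_cover_def edges_eq by blast
    show "\<forall>v\<in>C. \<exists>e\<in>snd H. e \<inter> C = {v}"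
    proof
      fix v assume v: "v \<in> C"
      have "\<exists>p\<in>V j. \<exists>q\<in>V (j + 1). t j \<le> q - p \<and> {p, q} \<inter> C = {v}"
      proof (cases "v \<in> V j")
        case True
        then have "v \<notin> V (j + 1)" using V_disj by auto
        then have "v \<le> i j + \<delta>" using v \<delta> by (auto simp: C_def V)
        moreover have q: "i (j + 1) \<in> V (j + 1)" using \<delta> by (simp add: V)
        moreover have "i (j + 1) \<notin> V j" using q V_disj by auto
        then have "i (j + 1) \<notin> C" using \<delta> by (auto simp: C_def V)
        ultimately show ?thesis
          using True v \<delta> by (intro bexI[of _ v] bexI[of _ "i (j + 1)"]) auto
      next
        case False
        then have v': "v \<in> {i (j + 1) + 1..i (j + 1) + int s - 1}" using v \<delta> by (auto simp: C_def V)
        moreover have p: "i j + \<delta> + 1 \<in> V j" using \<delta> by (simp add: V)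
        moreover have "i j + \<delta> + 1 \<notin> V (j + 1)" using p V_disj by auto
        then have "i j + \<delta> + 1 \<notin> C" using \<delta> by (auto simp: C_def V)
        ultimately show ?thesis
          using v \<delta> by (intro bexI[of _ "i j + \<delta> + 1"] bexI[of _ v]) (auto simp: V)
      qed
      then obtain p q where pq: "p \<in> V j" "q \<in> V (j + 1)" "t j \<le> q - p" "{p, q} \<inter> C = {v}" by blast
      obtain k where k: "spread k" "k j = p" "k (j + 1) = q"
        using spread_through_pair[OF j pq(1-3)] .
      then have "k ` {1..d} \<inter> C = {v}" using edge_Int pq(4) by simp
      then show "\<exists>e\<in>snd H. e \<inter> C = {v}" using k(1) edges_eq by blast
    qed
  qed
qed

definition diagonal :: "int \<Rightarrow> int set" where
  "diagonal a = (\<lambda>j. i j + a) ` {1..d}"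

lemma diagonal_vertex: "a \<in> {0..<int s} \<Longrightarrow> j \<in> {1..d} \<Longrightarrow> i j + a \<in> V j"
  by (simp add: parts_eq)

lemma diagonal_edge:
  assumes "a \<in> {0..<int s}"
  shows "diagonal a \<in> snd H"
proof -
  have "t j \<le> i (j + 1) + a - (i j + a)" if "j \<in> {1..<d}" for j
    using left_ends_gap[OF that] by simp
  then have "spread (\<lambda>j. i j + a)"
    unfolding spread_seq_def using diagonal_vertex[OF assms] by blast
  then show ?thesis unfolding edges_eq diagonal_def by blast
qed

text \<open>Suppose that \<open>C\<close> contains the vertices with offset \<open>a\<close> in parts \<open>j < k\<close>, and let \<open>g\<close> and \<open>f\<close> be private
edges of these. By \<open>minimal_cover_no_crossing\<close>, \<open>f\<close> cannot be continued by \<open>g\<close> at any step from \<open>j\<close> to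
\<open>k\<close>, so none of these steps allows all pairs, and all of them have \<open>\<delta> = 0\<close>. Then offsets do not
decrease along an edge between \<open>j\<close> and \<open>k\<close>: the offset of \<open>f\<close> in part \<open>j\<close> is at most \<open>a\<close>, and that of
\<open>g\<close> in part \<open>j + 1\<close> is at least \<open>a\<close>. Hence \<open>f\<close> can be continued by \<open>g\<close> at step \<open>j\<close> after all.\<close>

lemma minimal_cover_diagonal_unique:
  assumes steps: "\<And>j. j \<in> {1..<d} \<Longrightarrow>
      i (j + 1) - (i j + int s - 1) > t j - 1 \<or> i (j + 1) - i j = t j"
    and C: "minimal_cover H C" and a: "a \<in> {0..<int s}"
    and jk: "j \<in> {1..d}" "k \<in> {1..d}" "i j + a \<in> C" "i k + a \<in> C"
  shows "\<not> j < k"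
proof
  assume less: "j < k"
  obtain g where g: "spread g" "g j = i j + a" "\<forall>l\<in>{1..d}. g l \<in> C \<longrightarrow> l = j"
    using minimal_cover_private_spread[OF C jk(1) diagonal_vertex[OF a jk(1)] jk(3)] by blast
  obtain f where f: "spread f" "f k = i k + a" "\<forall>l\<in>{1..d}. f l \<in> C \<longrightarrow> l = k"
    using minimal_cover_private_spread[OF C jk(2) diagonal_vertex[OF a jk(2)] jk(4)] by blast
  have no_cross: "g (l + 1) - f l < t l" if "j \<le> l" "l < k" for l
    by (rule minimal_cover_no_crossing[OF C f(1,3) g(1,3) that])
  have rigid: "i (l + 1) - i l = t l" if l: "j \<le> l" "l < k" for l
  proof -
    have l': "l \<in> {1..<d}" "l \<in> {1..d}" "l + 1 \<in> {1..d}" using l jk by auto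
    have "f l \<le> i l + int s - 1" "i (l + 1) \<le> g (l + 1)"
      using spread_mem[OF f(1) l'(2)] spread_mem[OF g(1) l'(3)] parts_eq[OF l'(2)] parts_eq[OF l'(3)]
      by auto
    then show ?thesis using steps[OF l'(1)] no_cross[OF l] by linarith
  qed
  have "f j - i j \<le> f k - i k"
    using less_imp_le[OF less] rigid jk(2)
  proof (induction k rule: dec_induct)
    case (step l)
    then show ?case using spread_gap[OF f(1), of l] rigid[of l] jk(1) by force
  qed simp
  moreover have "t j \<le> g (j + 1) - g j" using spread_gap[OF g(1), of j] less jk by simp
  ultimately show False using no_cross[of j] less f(2) g(2) by simp
qed

text \<open>The diagonals are \<open>s\<close> edges that partition the vertex set, and \<open>C\<close> meets each of them exactly once.\<close>

lemma card_minimal_cover: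
  assumes steps: "\<And>j. j \<in> {1..<d} \<Longrightarrow>
      i (j + 1) - (i j + int s - 1) > t j - 1 \<or> i (j + 1) - i j = t j"
    and C: "minimal_cover H C"
  shows "card C = s"
proof -
  let ?A = "{0..<int s}"
  have one: "card (C \<inter> diagonal a) = 1" if a: "a \<in> ?A" for a
  proof -
    have "diagonal a \<inter> C \<noteq> {}"
      using C diagonal_edge[OF a] by (simp add: minimal_cover_def vertex_cover_def)
    moreover have "u = v" if uv: "u \<in> C \<inter> diagonal a" "v \<in> C \<inter> diagonal a" for u v
    proof -
      obtain j k where "j \<in> {1..d}" "k \<in> {1..d}" "u = i j + a" "v = i k + a"
        using uv unfolding diagonal_def by blast
      then show ?thesis
        using minimal_cover_diagonal_unique[OF steps C a, of j k]
          minimal_cover_diagonal_unique[OF steps C a, of k j] uv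
        by (metis IntD1 linorder_neqE_nat)
    qed
    ultimately have "\<exists>v. C \<inter> diagonal a = {v}" by blast
    then show ?thesis by auto
  qed
  have disj: "diagonal a \<inter> diagonal b = {}" if "a \<in> ?A" "b \<in> ?A" "a \<noteq> b" for a b
  proof -
    have "i j + a \<noteq> i k + b" if "j \<in> {1..d}" "k \<in> {1..d}" for j k
      using parts_disjoint[OF that] diagonal_vertex[OF \<open>a \<in> ?A\<close> that(1)]
        diagonal_vertex[OF \<open>b \<in> ?A\<close> that(2)] \<open>a \<noteq> b\<close>
      by (cases "j = k") auto
    then show ?thesis by (auto simp: diagonal_def)
  qed
  have "C \<subseteq> (\<Union>a\<in>?A. diagonal a)"
  proof
    fix v assume "v \<in> C"
    then obtain j where j: "j \<in> {1..d}" "v \<in> V j" using minimal_cover_subset_parts[OF C] by blast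
    then have "v - i j \<in> ?A" "v \<in> diagonal (v - i j)"
      by (auto simp: parts_eq diagonal_def intro!: image_eqI[of _ _ j])
    then show "v \<in> (\<Union>a\<in>?A. diagonal a)" by blast
  qed
  then have "C = (\<Union>a\<in>?A. C \<inter> diagonal a)" by blast
  also have "card \<dots> = (\<Sum>a\<in>?A. card (C \<inter> diagonal a))"
  proof (rule card_UN_disjoint)
    show "\<forall>a\<in>?A. finite (C \<inter> diagonal a)" by (simp add: diagonal_def)
    show "\<forall>a\<in>?A. \<forall>b\<in>?A. a \<noteq> b \<longrightarrow> C \<inter> diagonal a \<inter> (C \<inter> diagonal b) = {}"
      using disj by blast
  qed simp
  also have "\<dots> = s" by (simp add: one)
  finally show ?thesis .
qed

end

section \<open>Unmixed edge ideals\<close>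

theorem theorem4p9:
  fixes n d :: nat and t :: "nat \<Rightarrow> int" and V :: "nat \<Rightarrow> int set"
    and i :: "nat \<Rightarrow> int" and m :: "nat \<Rightarrow> nat"
    and S :: "((int \<Rightarrow>\<^sub>0 nat) \<Rightarrow>\<^sub>0 'k::field) ring"
  assumes "n \<ge> 1" and "d \<ge> 1"
    and "\<forall>j\<in>{1..<d}. t j \<ge> 1"
    and "\<forall>j\<in>{1..d}. V j \<noteq> {} \<and> V j \<subseteq> {1..int n}"
    and "\<forall>a\<in>{1..d}. \<forall>b\<in>{1..d}. a \<noteq> b \<longrightarrow> V a \<inter> V b = {}"
    and "\<forall>a\<in>{1..d}. \<forall>b\<in>{1..d}. a < b \<longrightarrow> (\<forall>p\<in>V a. \<forall>q\<in>V b. p < q)"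
    and "no_isolated_vertices (complete_spread_hypergraph d t V)"
    and "\<forall>j\<in>{1..d}. card (V j) = m j \<and> V j = {i j..i j + int (m j) - 1}"
    and "S = mpoly_ring {1..int n}"
  shows "unmixed S (edge_ideal {1..int n} (complete_spread_hypergraph d t V)) \<longleftrightarrow>
    (\<exists>s::nat. (\<forall>j\<in>{1..d}. m j = s) \<and>
       (\<forall>j\<in>{1..<d}. i (j + 1) - (i j + int s - 1) > t j - 1 \<or> i (j + 1) - i j = t j))"
    (is "?unmixed \<longleftrightarrow> (\<exists>s. ?uniform s \<and> ?steps s)")
proof -
  let ?X = "{1..int n}"
  let ?H = "complete_spread_hypergraph d t V"
  interpret spread_hypergraph d t V
  proof unfold_locales
    show "V a \<inter> V b = {}" if "a \<in> {1..d}" "b \<in> {1..d}" "a \<noteq> b" for a b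
      using assms(5) that by blast
  qed (rule assms(7))
  have intervals: "spread_interval_hypergraph d t V i s" if "?uniform s" for s
    using assms(4,8) that by unfold_locales auto
  have "\<Union> (snd ?H) \<subseteq> ?X"
    using spread_mem assms(4) unfolding edges_eq by blast
  then have iff: "?unmixed \<longleftrightarrow> (\<forall>C D. C \<subseteq> ?X \<longrightarrow> D \<subseteq> ?X \<longrightarrow>
      minimal_cover ?H C \<longrightarrow> minimal_cover ?H D \<longrightarrow> card C = card D)"
    unfolding assms(9) by (intro unmixed_edge_ideal_iff) simp_all
  show ?thesis
  proof
    assume ?unmixed
    then have same: "card C = card D" if "C \<subseteq> ?X" "D \<subseteq> ?X" "minimal_cover ?H C" "minimal_cover ?H D"
      for C D using that iff by blast
    have "m j = m 1" if "j \<in> {1..d}" for j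
    proof -
      have one: "1 \<in> {1..d}" using assms(2) by simp
      have "card (V j) = card (V 1)"
        using same[OF _ _ minimal_cover_part[OF that] minimal_cover_part[OF one]] assms(4) that one
        by blast
      then show ?thesis using assms(8) that one by simp
    qed
    then have uniform: "?uniform (m 1)" by blast
    then interpret spread_interval_hypergraph d t V i "m 1" by (rule intervals)
    have "?steps (m 1)"
    proof (rule ccontr)
      assume "\<not> ?steps (m 1)"
      then obtain j where j: "j \<in> {1..<d}" "i (j + 1) - (i j + int (m 1) - 1) \<le> t j - 1"
        "i (j + 1) - i j \<noteq> t j" by (auto simp: not_less)
      define \<delta> where "\<delta> = i (j + 1) - i j - t j"
      have \<delta>: "1 \<le> \<delta>" "\<delta> \<le> int (m 1) - 2" using j left_ends_gap[OF j(1)] by (auto simp: \<delta>_def)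
      note cover = staircase_cover[OF j(1) \<delta>_def \<delta>]
      have j': "j \<in> {1..d}" "j + 1 \<in> {1..d}" using j(1) by auto
      have sub: "V j \<subseteq> ?X" "V j \<union> V (j + 1) \<subseteq> ?X" using assms(4) j' by auto
      note eq = same[OF sub(1) subset_trans[OF cover(2) sub(2)] minimal_cover_part[OF j'(1)] cover(1)]
      have "int (card (V j)) = int (m 1) + \<delta>" unfolding eq by (rule cover(3))
      moreover have "card (V j) = m 1"
        using bspec[OF assms(8) j'(1)] bspec[OF uniform j'(1)] by simp
      ultimately show False using \<delta>(1) by simp
    qed
    with uniform show "\<exists>s. ?uniform s \<and> ?steps s" by (intro exI[of _ "m 1"] conjI)
  next
    assume "\<exists>s. ?uniform s \<and> ?steps s"
    then obtain s where s: "?uniform s" "?steps s" by (elim exE conjE)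
    interpret spread_interval_hypergraph d t V i s using s(1) by (rule intervals)
    have card: "card C = s" if "minimal_cover ?H C" for C
    proof (rule card_minimal_cover[OF _ that])
      show "i (j + 1) - (i j + int s - 1) > t j - 1 \<or> i (j + 1) - i j = t j" if "j \<in> {1..<d}" for j
        using s(2) that by (rule bspec)
    qed
    show ?unmixed unfolding iff by (simp add: card)
  qed
qed

end
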